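(* Let $N\ge 1$ be an integer and $\beta_N>0$. (1) Let $K=\{\omega_0,\dots,\omega_k\}\subset\mathbb{R}^2$ be a finite set of distinct points $\omega_s=(\lambda_s,\mu_s)$, and let $Q=(Q_0,\dots,Q_{N-1})\in SE(2,N,K)$ be given by $Q_r(x,y)=\sum_{s=0}^{k}a_{r,\lambda_s,\mu_s}e^{i(\lambda_s x+\mu_s y)}$, $r=0,\dots,N-1$, with $a_{r,\lambda_s,\mu_s}\in\mathbb{C}$. Then, for differentiable functions $a_r^s:[0,\infty)\to\mathbb{C}$ ($0\le r\le N-1$, $0\le s\le k$), the $SE(2,N,K)$-valued function $$\Psi_r(t,x,y)=\sum_{s=0}^{k}a_r^s(t)\,e^{i(\lambda_s x+\mu_s y)},\qquad r=0,\dots,N-1,$$ is a solution of the semi-discrete diffusion equation $$\frac{\partial\Psi_r}{\partial t}=\frac12\Bigl(\cos(\theta_r)\frac{\partial}{\partial x}+\sin(\theta_r)\frac{\partial}{\partial y}\Bigr)^2\Psi_r+\frac{\beta_N}{2}\bigl(\Psi_{r-1}-2\Psi_r+\Psi_{r+1}\bigr),\qquad r=0,\dots,N-1,$$ with initial condition $\Psi|_{t=0}=Q$ if and only if, for each $s=0,\dots,k$ separately, the vector $A^s(t)=(a^s_0(t),\dots,a^s_{N-1}(t))\in\mathbb{C}^N$ solves the $N$-dimensional linear system of ordinary differential equations $$\frac{da_r^s}{dt}=-\frac12\bigl(\lambda_s\cos(\theta_r)+\mu_s\sin(\theta_r)\bigr)^2a_r^s+\frac{\beta_N}{2}\bigl(a_{r+1}^s-2a_r^s+a_{r-1}^s\bigr),\qquad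 r=0,\dots,N-1,$$ with initial condition $a_r^s(0)=a_{r,\lambda_s,\mu_s}$. In other words, for an initial condition in $SE(2,N,K)$ the integration of the diffusion equation reduces to solving finitely many independent linear ordinary differential equations of dimension $N$ (one for each point of $K$). (2) For every compact subset $C$ of $SE(2,N)$, every continuous function $f:C\to\mathbb{C}$ and every $\varepsilon>0$, there exist a finite set $K\subset\mathbb{R}^2$ and $Q\in SE(2,N,K)$ such that $|f(x,y,r)-Q_r(x,y)|<\varepsilon$ for all $(x,y,r)\in C$.
   Context: Angles: $\theta_r=\frac{2\pi r}{N}$. All indices $r$ are taken modulo $N$ (so $\Psi_{-1}=\Psi_{N-1}$, $\Psi_N=\Psi_0$, and likewise for $a_r^s$). $i=\sqrt{-1}$. $SE(2,N)$ is the group of motions of the plane with rotations restricted to the angles $\frac{2\pi k}{N}$; as a topological space it is $\mathbb{R}^2\times\mathbb{Z}/N\mathbb{Z}$ (with $\mathbb{Z}/N\mathbb{Z}$ discrete). A function $f(x,y,r)$ on $SE(2,N)$ is identified with the $\mathbb{C}^N$-valued function on $\mathbb{R}^2$ having components $f_r(x,y)=f(x,y,r)$, $r=0,\dots,N-1$. For a finite set $K\subset\mathbb{R}^2$, $SE(2,N,K)$ denotes the vector space of $\mathbb{C}^N$-valued trigonometric polynomials $Q=(Q_0,\dots,Q_{N-1})$ on $\mathbb{R}^2$ with frequencies in $K$, i.e. $Q_r(x,y)=\sum_{(\lambda,\mu)\in K}a_{r,\lambda,\mu}e^{i(\lambda x+\mu y)}$ with $a_{r,\lambda,\mu}\in\mathbb{C}$.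 These are the "almost periodic polynomials". *)

theory Defs
  imports "HOL-Analysis.Analysis"
begin

text \<open>
  Residues modulo \<open>N\<close> are represented by \<open>{..<N}\<close>; a tuple \<open>(f\<^sub>0, \<dots>, f\<^sub>N\<^sub>-\<^sub>1)\<close> of
  functions on the plane is a function of \<open>r :: nat\<close> of which only the values at
  \<open>r < N\<close> are ever used.
\<close>

definition angle :: "nat \<Rightarrow> nat \<Rightarrow> real" where
  "angle N r = 2 * pi * real r / real N"

definition nxt :: "nat \<Rightarrow> nat \<Rightarrow> nat" where
  "nxt N r = (r + 1) mod N"

definition prv :: "nat \<Rightarrow> nat \<Rightarrow> nat" where
  "prv N r = (r + N - 1) mod N"

text \<open>
  The underlying set of \<open>SE(2,N)\<close>. Since the type-class topology of \<^typ>\<open>nat\<close> is discrete,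
  the subspace topology inherited from \<^typ>\<open>real \<times> real \<times> nat\<close> is that of
  the plane times the discrete space of residues.
\<close>

definition SE2 :: "nat \<Rightarrow> (real \<times> real \<times> nat) set" where
  "SE2 N = UNIV \<times> UNIV \<times> {..<N}"

definition plane_wave :: "real \<times> real \<Rightarrow> real \<Rightarrow> real \<Rightarrow> complex" where
  "plane_wave \<omega> x y = exp (\<i> * complex_of_real (fst \<omega> * x + snd \<omega> * y))"

text \<open>\<open>SE(2,N,K)\<close>; meaningful for finite \<open>K\<close> only.\<close>

definition SE2_trig :: "nat \<Rightarrow> (real \<times> real) set \<Rightarrow> (nat \<Rightarrow> real \<Rightarrow> real \<Rightarrow> complex) set" where
  "SE2_trig N K = {Q. \<exists>a :: nat \<Rightarrow> real \<times> real \<Rightarrow> complex.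
     \<forall>r<N. \<forall>x y. Q r x y = (\<Sum>\<omega>\<in>K. a r \<omega> * plane_wave \<omega> x y)}"

definition partial_x :: "(real \<Rightarrow> real \<Rightarrow> complex) \<Rightarrow> real \<Rightarrow> real \<Rightarrow> complex" where
  "partial_x f x y = vector_derivative (\<lambda>u. f u y) (at x)"

definition partial_y :: "(real \<Rightarrow> real \<Rightarrow> complex) \<Rightarrow> real \<Rightarrow> real \<Rightarrow> complex" where
  "partial_y f x y = vector_derivative (\<lambda>v. f x v) (at y)"

definition has_partials :: "(real \<Rightarrow> real \<Rightarrow> complex) \<Rightarrow> bool" where
  "has_partials f \<longleftrightarrow> (\<forall>x y. (\<lambda>u. f u y) differentiable (at x) \<and> (\<lambda>v. f x v) differentiable (at y))"

definition dir_deriv :: "real \<Rightarrow> (real \<Rightarrow> real \<Rightarrow> complex) \<Rightarrow> real \<Rightarrow> real \<Rightarrow> complex" where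
  "dir_deriv \<theta> f x y =
     complex_of_real (cos \<theta>) * partial_x f x y + complex_of_real (sin \<theta>) * partial_y f x y"

text \<open>
  Because \<^const>\<open>vector_derivative\<close> is total, a solution is explicitly required to have all
  partial derivatives of order at most two in space. The time derivative is one-sided at \<open>t = 0\<close>.
\<close>

definition diffusion_solution ::
    "nat \<Rightarrow> real \<Rightarrow> (real \<Rightarrow> nat \<Rightarrow> real \<Rightarrow> real \<Rightarrow> complex) \<Rightarrow> bool" where
  "diffusion_solution N \<beta> \<Psi> \<longleftrightarrow>
     (\<forall>t\<ge>0. \<forall>r<N.
        has_partials (\<Psi> t r) \<and> has_partials (partial_x (\<Psi> t r)) \<and> has_partials (partial_y (\<Psi> t r)) \<and>
        (\<forall>x y. ((\<lambda>\<tau>. \<Psi> \<tau> r x y) has_vector_derivative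
            (1 / 2) * dir_deriv (angle N r) (dir_deriv (angle N r) (\<Psi> t r)) x y
            + complex_of_real (\<beta> / 2)
                * (\<Psi> t (prv N r) x y - 2 * \<Psi> t r x y + \<Psi> t (nxt N r) x y))
          (at t within {0..})))"

definition ode_solution ::
    "nat \<Rightarrow> real \<Rightarrow> real \<times> real \<Rightarrow> (real \<Rightarrow> nat \<Rightarrow> complex) \<Rightarrow> bool" where
  "ode_solution N \<beta> \<omega> A \<longleftrightarrow>
     (\<forall>t\<ge>0. \<forall>r<N.
        ((\<lambda>\<tau>. A \<tau> r) has_vector_derivative
            - (1 / 2) * complex_of_real ((fst \<omega> * cos (angle N r) + snd \<omega> * sin (angle N r))\<^sup>2) * A t r
            + complex_of_real (\<beta> / 2) * (A t (nxt N r) - 2 * A t r + A t (prv N r)))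
          (at t within {0..}))"

end

theory Submission imports Defs begin

text \<open>
  Plane waves are at once the characters of the additive group of the plane and common
  eigenfunctions of the constant-coefficient operators in the diffusion equation: the directional
  derivative along \<open>\<theta>\<close> multiplies the wave of frequency \<open>(\<lambda>, \<mu>)\<close> by
  \<open>\<i> (\<lambda> cos \<theta> + \<mu> sin \<theta>)\<close>. Both assertions rest on these two properties.

  For the first assertion, the right-hand side of the diffusion equation applied to
  \<open>\<Sum>\<^sub>s a\<^sub>r\<^sup>s e\<^sub>s\<close> is the trigonometric sum whose \<open>s\<close>-th coefficient is
  the right-hand side of the \<open>s\<close>-th ordinary differential equation
  (\<open>diffusion_rhs_wave_sum\<close>), while the time derivative of the sum has coefficients
  \<open>da\<^sub>r\<^sup>s/dt\<close>. Distinct characters are linearly independent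
  (\<open>plane_waves_independent\<close>, Dedekind's argument), so the two sums agree on the plane if and
  only if the coefficients agree one by one. The initial conditions are compared in the same way.

  For the second assertion, a compact subset of \<open>SE(2,N)\<close> is a disjoint union of finitely many
  compact subsets of the plane, one for each rotation. On each of them the real-valued
  trigonometric polynomials form an algebra, because a product of characters is a character, and
  they separate points, because some character takes the value \<open>-1\<close> at any given nonzero vector
  (\<open>plane_wave_minus_one\<close>, with frequency and position exchanged). The Stone--Weierstrass theorem applies to the real and the imaginary
  part of the function, and the frequency sets of the finitely many approximants are merged.
\<close>

section \<open>Plane waves as characters of the plane\<close>

lemma plane_wave_add_freq: "plane_wave (\<omega> + \<nu>) x y = plane_wave \<omega> x y * plane_wave \<nu> x y"
  by (simp add: plane_wave_def flip: exp_add) (simp add: algebra_simps)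

lemma plane_wave_add_arg:
  "plane_wave \<omega> (x + u) (y + v) = plane_wave \<omega> u v * plane_wave \<omega> x y"
  by (simp add: plane_wave_def flip: exp_add) (simp add: algebra_simps)

lemma plane_wave_zero_freq [simp]: "plane_wave 0 x y = 1"
  by (simp add: plane_wave_def)

lemma plane_wave_zero_arg [simp]: "plane_wave \<omega> 0 0 = 1"
  by (simp add: plane_wave_def)

lemma plane_wave_nonzero [simp]: "plane_wave \<omega> x y \<noteq> 0"
  by (simp add: plane_wave_def)

lemma plane_wave_uminus_freq: "plane_wave (- \<omega>) x y = cnj (plane_wave \<omega> x y)"
  by (simp add: plane_wave_def exp_cnj algebra_simps)

text \<open>
  The pairing of the plane with its characters is nondegenerate. This gives both the
  independence of distinct waves and, since frequency and position play symmetric parts, the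
  separation of points.
\<close>

lemma plane_wave_minus_one:
  assumes "\<omega> \<noteq> 0"
  obtains u v where "plane_wave \<omega> u v = -1"
proof (cases "fst \<omega> = 0")
  case False
  then have "plane_wave \<omega> (pi / fst \<omega>) 0 = -1"
    by (simp add: plane_wave_def mult.commute)
  with that show thesis .
next
  case True
  with assms have "snd \<omega> \<noteq> 0"
    by (simp add: prod_eq_iff)
  then have "plane_wave \<omega> 0 (pi / snd \<omega>) = -1"
    by (simp add: plane_wave_def mult.commute)
  with that show thesis .
qed

lemma plane_waves_distinct:
  assumes "\<omega> \<noteq> \<nu>"
  obtains u v where "plane_wave \<omega> u v \<noteq> plane_wave \<nu> u v"
proof -
  obtain u v where "plane_wave (\<omega> - \<nu>) u v = -1"
    using assms by (metis plane_wave_minus_one right_minus_eq)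
  then have "plane_wave \<omega> u v = - plane_wave \<nu> u v"
    using plane_wave_add_freq[of "\<omega> - \<nu>" \<nu> u v] by simp
  then show thesis
    using that[of u v] by auto
qed

text \<open>
  Frequencies are indexed by a set \<open>S\<close> through \<open>\<omega>\<close>, because the coefficients
  \<open>a\<^sub>r\<^sup>s\<close> are attached to indices and not to frequencies.
\<close>

definition wave_sum ::
    "'i set \<Rightarrow> ('i \<Rightarrow> real \<times> real) \<Rightarrow> ('i \<Rightarrow> complex) \<Rightarrow> real \<Rightarrow> real \<Rightarrow> complex" where
  "wave_sum S \<omega> b x y = (\<Sum>s\<in>S. b s * plane_wave (\<omega> s) x y)"

lemma wave_sum_add:
  "wave_sum S \<omega> (\<lambda>s. b s + b' s) x y = wave_sum S \<omega> b x y + wave_sum S \<omega> b' x y"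
  by (simp add: wave_sum_def distrib_right sum.distrib)

lemma wave_sum_diff:
  "wave_sum S \<omega> (\<lambda>s. b s - b' s) x y = wave_sum S \<omega> b x y - wave_sum S \<omega> b' x y"
  by (simp add: wave_sum_def left_diff_distrib sum_subtractf)

lemma wave_sum_mult: "wave_sum S \<omega> (\<lambda>s. c * b s) x y = c * wave_sum S \<omega> b x y"
  by (simp add: wave_sum_def sum_distrib_left mult.assoc)

text \<open>
  Dedekind's argument. Translating a vanishing sum by \<open>(u, v)\<close> multiplies each coefficient by the
  value of its character there; subtracting a multiple of the original sum removes one character
  and keeps the others with a factor that is nonzero for a suitable \<open>(u, v)\<close>.
\<close>

lemma plane_waves_independent:
  assumes "finite S" "inj_on \<omega> S" "\<And>x y. wave_sum S \<omega> b x y = 0" "s \<in> S"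
  shows "b s = 0"
  using assms
proof (induction S arbitrary: b s rule: finite_induct)
  case empty
  then show ?case by simp
next
  case (insert p S)
  have total: "b p * plane_wave (\<omega> p) x y + wave_sum S \<omega> b x y = 0" for x y
    using insert.prems(2)[of x y] insert.hyps by (simp add: wave_sum_def)
  have on_S: "b q = 0" if q: "q \<in> S" for q
  proof -
    have "\<omega> q \<noteq> \<omega> p"
      using insert.prems(1) insert.hyps q by (auto simp: inj_on_def)
    then obtain u v where uv: "plane_wave (\<omega> q) u v \<noteq> plane_wave (\<omega> p) u v"
      by (rule plane_waves_distinct)
    define b' where "b' t = (plane_wave (\<omega> t) u v - plane_wave (\<omega> p) u v) * b t" for t
    have "wave_sum S \<omega> b' x y = 0" for x y
    proof -
      have "wave_sum S \<omega> b' x y =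
          wave_sum S \<omega> b (x + u) (y + v) - plane_wave (\<omega> p) u v * wave_sum S \<omega> b x y"
        by (simp add: wave_sum_def b'_def plane_wave_add_arg sum_distrib_left algebra_simps
            flip: sum_subtractf)
      also have "wave_sum S \<omega> b (x + u) (y + v) =
          - (b p * (plane_wave (\<omega> p) u v * plane_wave (\<omega> p) x y))"
        using total[of "x + u" "y + v"] by (simp add: plane_wave_add_arg add_eq_0_iff2)
      also have "wave_sum S \<omega> b x y = - (b p * plane_wave (\<omega> p) x y)"
        using total[of x y] by (simp add: add_eq_0_iff2)
      finally show ?thesis
        by (simp add: algebra_simps)
    qed
    then have "b' q = 0"
      using insert.IH[of b' q] insert.prems(1) q by auto
    with uv show ?thesis
      by (simp add: b'_def)
  qed
  then have "b p = 0"
    using total[of 0 0] by (simp add: wave_sum_def)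
  with on_S insert.prems(3) show ?case
    by auto
qed

corollary wave_sum_cancel:
  assumes "finite S" "inj_on \<omega> S" "\<And>x y. wave_sum S \<omega> b x y = wave_sum S \<omega> b' x y" "s \<in> S"
  shows "b s = b' s"
  using plane_waves_independent[of S \<omega> "\<lambda>s. b s - b' s" s] assms by (simp add: wave_sum_diff)

section \<open>The diffusion operator on trigonometric sums\<close>

lemma plane_wave_has_derivative_x:
  "((\<lambda>u. plane_wave \<omega> u y) has_vector_derivative \<i> * of_real (fst \<omega>) * plane_wave \<omega> x y) (at x)"
proof -
  have "((\<lambda>u. \<i> * complex_of_real (fst \<omega> * u + snd \<omega> * y)) has_vector_derivative
      \<i> * of_real (fst \<omega>)) (at x)"
    by (auto intro!: derivative_eq_intros)
  from field_vector_diff_chain_at[OF this DERIV_exp] show ?thesis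
    by (simp add: o_def plane_wave_def)
qed

lemma plane_wave_has_derivative_y:
  "((\<lambda>v. plane_wave \<omega> x v) has_vector_derivative \<i> * of_real (snd \<omega>) * plane_wave \<omega> x y) (at y)"
  using plane_wave_has_derivative_x[of "(snd \<omega>, fst \<omega>)" x y]
  by (simp add: plane_wave_def add.commute)

lemma wave_sum_has_derivative_x:
  "((\<lambda>u. wave_sum S \<omega> b u y) has_vector_derivative
     wave_sum S \<omega> (\<lambda>s. \<i> * of_real (fst (\<omega> s)) * b s) x y) (at x)"
  unfolding wave_sum_def
  by (auto intro!: derivative_eq_intros plane_wave_has_derivative_x sum.cong simp: ac_simps)

lemma wave_sum_has_derivative_y:
  "((\<lambda>v. wave_sum S \<omega> b x v) has_vector_derivative
     wave_sum S \<omega> (\<lambda>s. \<i> * of_real (snd (\<omega> s)) * b s) x y) (at y)"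
  unfolding wave_sum_def
  by (auto intro!: derivative_eq_intros plane_wave_has_derivative_y sum.cong simp: ac_simps)

lemma partial_x_wave_sum:
  "partial_x (wave_sum S \<omega> b) = wave_sum S \<omega> (\<lambda>s. \<i> * of_real (fst (\<omega> s)) * b s)"
  by (intro ext) (simp add: partial_x_def vector_derivative_at[OF wave_sum_has_derivative_x])

lemma partial_y_wave_sum:
  "partial_y (wave_sum S \<omega> b) = wave_sum S \<omega> (\<lambda>s. \<i> * of_real (snd (\<omega> s)) * b s)"
  by (intro ext) (simp add: partial_y_def vector_derivative_at[OF wave_sum_has_derivative_y])

lemma has_partials_wave_sum: "has_partials (wave_sum S \<omega> b)"
  unfolding has_partials_def
  by (intro allI conjI differentiableI_vector[OF wave_sum_has_derivative_x]
      differentiableI_vector[OF wave_sum_has_derivative_y])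

lemma dir_deriv_wave_sum:
  "dir_deriv \<theta> (wave_sum S \<omega> b) =
     wave_sum S \<omega> (\<lambda>s. \<i> * of_real (fst (\<omega> s) * cos \<theta> + snd (\<omega> s) * sin \<theta>) * b s)"
  by (intro ext)
     (simp add: dir_deriv_def partial_x_wave_sum partial_y_wave_sum wave_sum_def
       sum_distrib_left algebra_simps flip: sum.distrib)

lemma dir_deriv_twice_wave_sum:
  "dir_deriv \<theta> (dir_deriv \<theta> (wave_sum S \<omega> b)) =
     wave_sum S \<omega> (\<lambda>s. - of_real ((fst (\<omega> s) * cos \<theta> + snd (\<omega> s) * sin \<theta>)\<^sup>2) * b s)"
proof -
  have "\<i> * of_real c * (\<i> * of_real c * z) = - of_real (c\<^sup>2) * z" for c :: real and z
    by (simp add: power2_eq_square complex_eq_iff)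
  then show ?thesis
    by (simp only: dir_deriv_wave_sum)
qed

definition ode_rhs ::
    "nat \<Rightarrow> real \<Rightarrow> real \<times> real \<Rightarrow> (nat \<Rightarrow> complex) \<Rightarrow> nat \<Rightarrow> complex" where
  "ode_rhs N \<beta> \<nu> A r =
     - (1 / 2) * complex_of_real ((fst \<nu> * cos (angle N r) + snd \<nu> * sin (angle N r))\<^sup>2) * A r
     + complex_of_real (\<beta> / 2) * (A (nxt N r) - 2 * A r + A (prv N r))"

lemma ode_solution_iff:
  "ode_solution N \<beta> \<nu> A \<longleftrightarrow>
     (\<forall>t\<ge>0. \<forall>r<N. ((\<lambda>\<tau>. A \<tau> r) has_vector_derivative ode_rhs N \<beta> \<nu> (A t) r) (at t within {0..}))"
  by (simp add: ode_solution_def ode_rhs_def)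

lemma diffusion_rhs_wave_sum:
  "(1 / 2) * dir_deriv (angle N r) (dir_deriv (angle N r) (wave_sum S \<omega> (\<lambda>s. A s r))) x y
     + complex_of_real (\<beta> / 2) *
       (wave_sum S \<omega> (\<lambda>s. A s (prv N r)) x y - 2 * wave_sum S \<omega> (\<lambda>s. A s r) x y
         + wave_sum S \<omega> (\<lambda>s. A s (nxt N r)) x y)
   = wave_sum S \<omega> (\<lambda>s. ode_rhs N \<beta> (\<omega> s) (A s) r) x y"
proof -
  have "ode_rhs N \<beta> (\<omega> s) (A s) r =
      (1 / 2) * (- complex_of_real ((fst (\<omega> s) * cos (angle N r) + snd (\<omega> s) * sin (angle N r))\<^sup>2)
        * A s r)
      + complex_of_real (\<beta> / 2) * ((A s (prv N r) - 2 * A s r) + A s (nxt N r))" for s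
    by (simp add: ode_rhs_def algebra_simps)
  then show ?thesis
    by (simp only: dir_deriv_twice_wave_sum wave_sum_add wave_sum_diff wave_sum_mult)
qed

lemma at_within_halfline_nontrivial: "t \<ge> 0 \<Longrightarrow> at t within {0::real..} \<noteq> bot"
  using islimpt_subset[of t "{t..t + 1}" "{0..}"]
  by (auto simp: trivial_limit_within islimpt_Icc)

text \<open>
  At fixed \<open>t\<close> and \<open>r\<close>, the coefficientwise equations imply the equation for the sum by linearity.
  Conversely the coefficients are differentiable by assumption, so the derivative of the sum is
  the sum with the derivatives of the coefficients, and independence of the waves applies.
\<close>

lemma wave_sum_has_time_derivative_iff:
  fixes a :: "'i \<Rightarrow> real \<Rightarrow> complex"
  assumes S: "finite S" "inj_on \<omega> S" and t: "at t within T \<noteq> bot"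
    and diff: "\<And>s. s \<in> S \<Longrightarrow> a s differentiable (at t within T)"
  shows "(\<forall>x y. ((\<lambda>\<tau>. wave_sum S \<omega> (\<lambda>s. a s \<tau>) x y) has_vector_derivative wave_sum S \<omega> g x y)
            (at t within T)) \<longleftrightarrow>
         (\<forall>s\<in>S. (a s has_vector_derivative g s) (at t within T))"
    (is "?sum \<longleftrightarrow> ?coeffs")
proof -
  have deriv: "((\<lambda>\<tau>. wave_sum S \<omega> (\<lambda>s. a s \<tau>) x y) has_vector_derivative wave_sum S \<omega> d x y)
      (at t within T)"
    if "\<And>s. s \<in> S \<Longrightarrow> (a s has_vector_derivative d s) (at t within T)" for d x y
    unfolding wave_sum_def
    by (intro has_vector_derivative_sum has_vector_derivative_mult_left that)
  show ?thesis
  proof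
    assume sum: ?sum
    define d where "d s = vector_derivative (a s) (at t within T)" for s
    have d: "(a s has_vector_derivative d s) (at t within T)" if "s \<in> S" for s
      unfolding d_def using diff[OF that] by (simp add: vector_derivative_works)
    have "wave_sum S \<omega> d x y = wave_sum S \<omega> g x y" for x y
      using vector_derivative_unique_within[OF t deriv[OF d]] sum by blast
    then have "d s = g s" if "s \<in> S" for s
      using wave_sum_cancel[OF S _ that] by blast
    with d show ?coeffs
      by metis
  next
    assume ?coeffs
    then show ?sum
      by (auto intro: deriv)
  qed
qed

text \<open>
  For fixed \<open>t\<close> and \<open>r\<close> this is \<open>wave_sum_has_time_derivative_iff\<close>, because the right-hand side of
  the diffusion equation is a sum of the same waves by \<open>diffusion_rhs_wave_sum\<close>. The neighbours
  \<open>r - 1\<close> and \<open>r + 1\<close> are reduced modulo \<open>N\<close>, so the hypothesis on \<open>\<Psi>\<close> covers them.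
\<close>

lemma diffusion_solution_wave_sum_iff:
  fixes a :: "nat \<Rightarrow> 'i \<Rightarrow> real \<Rightarrow> complex"
  assumes N: "N \<ge> 1" and S: "finite S" "inj_on \<omega> S"
    and diff: "\<And>r s. r < N \<Longrightarrow> s \<in> S \<Longrightarrow> a r s differentiable_on {0..}"
    and \<Psi>: "\<And>t r x y. t \<ge> 0 \<Longrightarrow> r < N \<Longrightarrow> \<Psi> t r x y = wave_sum S \<omega> (\<lambda>s. a r s t) x y"
  shows "diffusion_solution N \<beta> \<Psi> \<longleftrightarrow> (\<forall>s\<in>S. ode_solution N \<beta> (\<omega> s) (\<lambda>t r. a r s t))"
proof -
  have pointwise:
    "has_partials (\<Psi> t r) \<and> has_partials (partial_x (\<Psi> t r)) \<and> has_partials (partial_y (\<Psi> t r)) \<and>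
       (\<forall>x y. ((\<lambda>\<tau>. \<Psi> \<tau> r x y) has_vector_derivative
          (1 / 2) * dir_deriv (angle N r) (dir_deriv (angle N r) (\<Psi> t r)) x y
          + complex_of_real (\<beta> / 2)
              * (\<Psi> t (prv N r) x y - 2 * \<Psi> t r x y + \<Psi> t (nxt N r) x y))
        (at t within {0..})) \<longleftrightarrow>
     (\<forall>s\<in>S. (a r s has_vector_derivative ode_rhs N \<beta> (\<omega> s) (\<lambda>r. a r s t) r) (at t within {0..}))"
    if t: "t \<ge> 0" and r: "r < N" for t r
  proof -
    have eq: "\<Psi> t r' = wave_sum S \<omega> (\<lambda>s. a r' s t)" if "r' < N" for r'
      using \<Psi>[OF t that] by (intro ext)
    have nbr: "prv N r < N" "nxt N r < N"
      using N by (simp_all add: prv_def nxt_def)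
    have time: "((\<lambda>\<tau>. \<Psi> \<tau> r x y) has_vector_derivative D) (at t within {0..}) \<longleftrightarrow>
        ((\<lambda>\<tau>. wave_sum S \<omega> (\<lambda>s. a r s \<tau>) x y) has_vector_derivative D) (at t within {0..})"
      for x y D
      by (rule has_vector_derivative_cong_ev) (use \<Psi> r t in auto)
    have "a r s differentiable (at t within {0..})" if "s \<in> S" for s
      using diff[OF r that] t by (simp add: differentiable_on_def)
    from wave_sum_has_time_derivative_iff[OF S at_within_halfline_nontrivial[OF t] this]
    show ?thesis
      unfolding time eq[OF r] eq[OF nbr(1)] eq[OF nbr(2)]
        diffusion_rhs_wave_sum[where A = "\<lambda>s r. a r s t"] partial_x_wave_sum partial_y_wave_sum
      by (simp add: has_partials_wave_sum)
  qed
  have "diffusion_solution N \<beta> \<Psi> \<longleftrightarrow>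
      (\<forall>t\<ge>0. \<forall>r<N. \<forall>s\<in>S.
         (a r s has_vector_derivative ode_rhs N \<beta> (\<omega> s) (\<lambda>r. a r s t) r) (at t within {0..}))"
    unfolding diffusion_solution_def by (simp only: pointwise cong: imp_cong)
  then show ?thesis
    unfolding ode_solution_iff by blast
qed

section \<open>The algebra of trigonometric polynomials\<close>

definition trig_polynomial :: "(real \<Rightarrow> real \<Rightarrow> complex) \<Rightarrow> bool" where
  "trig_polynomial p \<longleftrightarrow> (\<exists>K b. finite K \<and> p = wave_sum K (\<lambda>\<omega>. \<omega>) b)"

lemma wave_sum_extend:
  assumes "finite L" "K \<subseteq> L"
  shows "wave_sum K \<omega> b = wave_sum L \<omega> (\<lambda>s. if s \<in> K then b s else 0)"
  using assms
  by (intro ext) (auto simp: wave_sum_def intro!: sum.mono_neutral_cong_left)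

lemma trig_polynomial_add:
  assumes "trig_polynomial p" "trig_polynomial q"
  shows "trig_polynomial (\<lambda>x y. p x y + q x y)"
proof -
  obtain K b L c where K: "finite K" "p = wave_sum K (\<lambda>\<omega>. \<omega>) b"
    and L: "finite L" "q = wave_sum L (\<lambda>\<omega>. \<omega>) c"
    using assms by (auto simp: trig_polynomial_def)
  have "p = wave_sum (K \<union> L) (\<lambda>\<omega>. \<omega>) (\<lambda>s. if s \<in> K then b s else 0)"
    "q = wave_sum (K \<union> L) (\<lambda>\<omega>. \<omega>) (\<lambda>s. if s \<in> L then c s else 0)"
    using K L by (auto intro!: wave_sum_extend)
  then show ?thesis
    unfolding trig_polynomial_def using K L by (auto simp flip: wave_sum_add)
qed

lemma trig_polynomial_wave: "trig_polynomial (\<lambda>x y. c * plane_wave \<omega> x y)"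
  unfolding trig_polynomial_def
  by (rule exI[of _ "{\<omega>}"], rule exI[of _ "\<lambda>_. c"]) (auto simp: wave_sum_def fun_eq_iff)

lemma trig_polynomial_const: "trig_polynomial (\<lambda>x y. c)"
  using trig_polynomial_wave[of c 0] by simp

lemma trig_polynomial_sum:
  assumes "finite I" "\<And>i. i \<in> I \<Longrightarrow> trig_polynomial (p i)"
  shows "trig_polynomial (\<lambda>x y. \<Sum>i\<in>I. p i x y)"
  using assms by induction (simp_all add: trig_polynomial_const trig_polynomial_add)

lemma trig_polynomial_mult:
  assumes "trig_polynomial p" "trig_polynomial q"
  shows "trig_polynomial (\<lambda>x y. p x y * q x y)"
proof -
  obtain K b L c where K: "finite K" "p = wave_sum K (\<lambda>\<omega>. \<omega>) b"
    and L: "finite L" "q = wave_sum L (\<lambda>\<omega>. \<omega>) c"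
    using assms by (auto simp: trig_polynomial_def)
  have "(\<lambda>x y. p x y * q x y) =
      (\<lambda>x y. \<Sum>\<omega>\<in>K. \<Sum>\<nu>\<in>L. (b \<omega> * c \<nu>) * plane_wave (\<omega> + \<nu>) x y)"
    by (simp add: K L wave_sum_def sum_product plane_wave_add_freq ac_simps)
  then show ?thesis
    using K L by (simp add: trig_polynomial_sum trig_polynomial_wave)
qed

lemma continuous_on_trig_polynomial:
  "trig_polynomial p \<Longrightarrow> continuous_on S (\<lambda>z. p (fst z) (snd z))"
  by (auto simp: trig_polynomial_def wave_sum_def plane_wave_def intro!: continuous_intros)

text \<open>
  The separating function is the cosine wave that is \<open>1\<close> at \<open>z\<close>, of a frequency for which it
  is \<open>-1\<close> at \<open>w\<close>.
\<close>

lemma trig_polynomials_separate_points: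
  fixes z w :: "real \<times> real"
  assumes "z \<noteq> w"
  obtains g :: "real \<times> real \<Rightarrow> real"
  where "trig_polynomial (\<lambda>x y. of_real (g (x, y)))" "g z \<noteq> g w"
proof -
  from assms obtain u v where uv: "plane_wave (w - z) u v = -1"
    by (metis plane_wave_minus_one right_minus_eq)
  define h where "h x y = plane_wave (u, v) (x - fst z) (y - snd z)" for x y
  define g where "g p = Re (h (fst p) (snd p))" for p
  have h: "h x y = plane_wave (u, v) (- fst z) (- snd z) * plane_wave (u, v) x y" for x y
    using plane_wave_add_arg[of "(u, v)" x "- fst z" y "- snd z"] by (simp add: h_def)
  have "complex_of_real (g (x, y)) =
      (plane_wave (u, v) (- fst z) (- snd z) / 2) * plane_wave (u, v) x y
      + (cnj (plane_wave (u, v) (- fst z) (- snd z)) / 2) * plane_wave (- (u, v)) x y" for x y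
    unfolding plane_wave_uminus_freq g_def fst_conv snd_conv h
    using complex_add_cnj[of "plane_wave (u, v) (- fst z) (- snd z) * plane_wave (u, v) x y"]
    by (simp add: field_simps)
  then have "trig_polynomial (\<lambda>x y. of_real (g (x, y)))"
    by (simp only: trig_polynomial_add trig_polynomial_wave)
  moreover have "g z = 1"
    by (simp add: g_def h_def)
  moreover have "g w = -1"
  proof -
    have "h (fst w) (snd w) = plane_wave (w - z) u v"
      by (simp add: h_def plane_wave_def mult.commute)
    with uv show ?thesis
      by (simp add: g_def)
  qed
  ultimately show thesis
    using that by simp
qed

section \<open>Uniform approximation on compact sets\<close>

lemma trig_polynomial_approx_real:
  fixes f :: "real \<times> real \<Rightarrow> real"
  assumes "compact S" "continuous_on S f" "\<epsilon> > 0"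
  obtains g where "trig_polynomial (\<lambda>x y. of_real (g (x, y)))" "\<And>z. z \<in> S \<Longrightarrow> \<bar>f z - g z\<bar> < \<epsilon>"
proof -
  let ?P = "\<lambda>g :: real \<times> real \<Rightarrow> real. trig_polynomial (\<lambda>x y. of_real (g (x, y)))"
  have "\<exists>g. ?P g \<and> (\<forall>z\<in>S. \<bar>f z - g z\<bar> < \<epsilon>)"
  proof (rule Stone_Weierstrass_HOL[OF assms(1)])
    show "?P (\<lambda>z. c)" for c
      by (rule trig_polynomial_const)
    show "continuous_on S g" if "?P g" for g
    proof -
      have "continuous_on S (\<lambda>z. Re (of_real (g (fst z, snd z))))"
        by (intro continuous_on_Re continuous_on_trig_polynomial[OF that])
      then show ?thesis
        by simp
    qed
    show "?P (\<lambda>z. g z + g' z)" if "?P g \<and> ?P g'" for g g'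
      using trig_polynomial_add[of "\<lambda>x y. of_real (g (x, y))" "\<lambda>x y. of_real (g' (x, y))"] that
      by simp
    show "?P (\<lambda>z. g z * g' z)" if "?P g \<and> ?P g'" for g g'
      using trig_polynomial_mult[of "\<lambda>x y. of_real (g (x, y))" "\<lambda>x y. of_real (g' (x, y))"] that
      by simp
    show "\<exists>g. ?P g \<and> g z \<noteq> g w" if "z \<in> S \<and> w \<in> S \<and> z \<noteq> w" for z w
      using that by (metis trig_polynomials_separate_points)
  qed (use assms in auto)
  then show thesis
    using that by blast
qed

lemma trig_polynomial_approx:
  fixes f :: "real \<times> real \<Rightarrow> complex"
  assumes "compact S" "continuous_on S f" "\<epsilon> > 0"
  obtains p where "trig_polynomial p" "\<And>x y. (x, y) \<in> S \<Longrightarrow> cmod (f (x, y) - p x y) < \<epsilon>"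
proof -
  have cont: "continuous_on S (\<lambda>z. Re (f z))" "continuous_on S (\<lambda>z. Im (f z))"
    using assms(2) by (auto intro: continuous_intros)
  have half: "\<epsilon> / 2 > 0"
    using assms(3) by simp
  obtain g where
    g: "trig_polynomial (\<lambda>x y. of_real (g (x, y)))" "\<And>z. z \<in> S \<Longrightarrow> \<bar>Re (f z) - g z\<bar> < \<epsilon> / 2"
    using trig_polynomial_approx_real[OF assms(1) cont(1) half] by blast
  obtain h where
    h: "trig_polynomial (\<lambda>x y. of_real (h (x, y)))" "\<And>z. z \<in> S \<Longrightarrow> \<bar>Im (f z) - h z\<bar> < \<epsilon> / 2"
    using trig_polynomial_approx_real[OF assms(1) cont(2) half] by blast
  have "trig_polynomial (\<lambda>x y. of_real (g (x, y)) + \<i> * of_real (h (x, y)))"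
    by (intro trig_polynomial_add trig_polynomial_mult trig_polynomial_const g h)
  moreover have "cmod (f z - (of_real (g z) + \<i> * of_real (h z))) < \<epsilon>" if "z \<in> S" for z
    using cmod_le[of "f z - (of_real (g z) + \<i> * of_real (h z))"] g(2)[OF that] h(2)[OF that]
    by simp
  ultimately show thesis
    using that by blast
qed

lemma trig_polynomials_in_SE2_trig:
  assumes "\<And>r. r < N \<Longrightarrow> trig_polynomial (Q r)"
  obtains K where "finite K" "Q \<in> SE2_trig N K"
proof -
  from assms obtain K b
    where K: "\<And>r. r < N \<Longrightarrow> finite (K r)" "\<And>r. r < N \<Longrightarrow> Q r = wave_sum (K r) (\<lambda>\<omega>. \<omega>) (b r)"
    unfolding trig_polynomial_def by metis
  define L where "L = (\<Union>r<N. K r)"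
  have L: "finite L"
    using K by (auto simp: L_def)
  have "Q r = wave_sum L (\<lambda>\<omega>. \<omega>) (\<lambda>s. if s \<in> K r then b r s else 0)" if "r < N" for r
    unfolding K(2)[OF that] using that by (intro wave_sum_extend L) (auto simp: L_def)
  then have "Q \<in> SE2_trig N L"
    unfolding SE2_trig_def
    by (auto simp: wave_sum_def intro!: exI[of _ "\<lambda>r s. if s \<in> K r then b r s else 0"])
  with L that show thesis
    by blast
qed

lemma compact_slice:
  fixes C :: "(real \<times> real \<times> nat) set"
  assumes "compact C"
  shows "compact {(x, y). (x, y, r) \<in> C}"
proof -
  have "closed {p :: real \<times> real \<times> nat. snd (snd p) = r}"
    by (intro closed_Collect_eq continuous_intros)
  then have "compact (C \<inter> {p. snd (snd p) = r})"
    using assms by (simp add: compact_Int_closed)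
  then have "compact ((\<lambda>p. (fst p, fst (snd p))) ` (C \<inter> {p. snd (snd p) = r}))"
    by (intro compact_continuous_image continuous_intros)
  also have "(\<lambda>p. (fst p, fst (snd p))) ` (C \<inter> {p. snd (snd p) = r}) = {(x, y). (x, y, r) \<in> C}"
    by force
  finally show ?thesis .
qed

lemma SE2_trig_dense:
  fixes C :: "(real \<times> real \<times> nat) set" and f :: "real \<times> real \<times> nat \<Rightarrow> complex"
  assumes C: "compact C" and f: "continuous_on C f" and \<epsilon>: "\<epsilon> > 0"
  shows "\<exists>K Q. finite K \<and> Q \<in> SE2_trig N K \<and> (\<forall>(x, y, r)\<in>C. cmod (f (x, y, r) - Q r x y) < \<epsilon>)"
proof -
  have "\<exists>p. trig_polynomial p \<and> (\<forall>x y. (x, y, r) \<in> C \<longrightarrow> cmod (f (x, y, r) - p x y) < \<epsilon>)" for r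
  proof -
    have "continuous_on {(x, y). (x, y, r) \<in> C} (\<lambda>z. f (fst z, snd z, r))"
      by (rule continuous_on_compose2[OF f]) (auto intro!: continuous_intros)
    then obtain p where "trig_polynomial p"
      "\<And>x y. (x, y) \<in> {(x, y). (x, y, r) \<in> C} \<Longrightarrow>
        cmod (f (fst (x, y), snd (x, y), r) - p x y) < \<epsilon>"
      using trig_polynomial_approx[OF compact_slice[OF C] _ \<epsilon>] by blast
    then show ?thesis
      by auto
  qed
  then obtain Q where Q: "\<And>r. trig_polynomial (Q r)"
    "\<And>r x y. (x, y, r) \<in> C \<Longrightarrow> cmod (f (x, y, r) - Q r x y) < \<epsilon>"
    by metis
  from Q(1) obtain K where "finite K" "Q \<in> SE2_trig N K"
    using trig_polynomials_in_SE2_trig[of N Q] by blast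
  with Q(2) show ?thesis
    by blast
qed

section \<open>Reduction of the diffusion equation and density\<close>

text \<open>
  Coefficients in \<open>SE(2,N,K)\<close> are indexed by frequencies, so distinctness of the
  \<open>\<omega> s\<close> is what lets the index be recovered from the frequency.
\<close>

lemma wave_sums_in_SE2_trig:
  assumes "finite S" "inj_on \<omega> S" "\<And>r x y. r < N \<Longrightarrow> F r x y = wave_sum S \<omega> (b r) x y"
  shows "F \<in> SE2_trig N (\<omega> ` S)"
  unfolding SE2_trig_def
  using assms
  by (auto simp: wave_sum_def sum.reindex intro!: exI[of _ "\<lambda>r \<nu>. b r (the_inv_into S \<omega> \<nu>)"]
      sum.cong simp: the_inv_into_f_f)

theorem diffusion_reduces_to_odes:
  assumes N: "N \<ge> 1" and S: "finite S" "inj_on \<omega> S"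
    and Q: "\<And>r x y. r < N \<Longrightarrow> Q r x y = wave_sum S \<omega> (\<lambda>s. c r (\<omega> s)) x y"
    and diff: "\<And>r s. r < N \<Longrightarrow> s \<in> S \<Longrightarrow> a r s differentiable_on {0..}"
    and \<Psi>: "\<And>t r x y. t \<ge> 0 \<Longrightarrow> r < N \<Longrightarrow> \<Psi> t r x y = wave_sum S \<omega> (\<lambda>s. a r s t) x y"
  shows "(diffusion_solution N \<beta> \<Psi> \<and> (\<forall>r<N. \<forall>x y. \<Psi> 0 r x y = Q r x y)) \<longleftrightarrow>
         (\<forall>s\<in>S. ode_solution N \<beta> (\<omega> s) (\<lambda>t r. a r s t) \<and> (\<forall>r<N. a r s 0 = c r (\<omega> s)))"
proof -
  have "(\<forall>x y. \<Psi> 0 r x y = Q r x y) \<longleftrightarrow> (\<forall>s\<in>S. a r s 0 = c r (\<omega> s))" if r: "r < N" for r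
  proof
    assume "\<forall>x y. \<Psi> 0 r x y = Q r x y"
    then have "wave_sum S \<omega> (\<lambda>s. a r s 0) x y = wave_sum S \<omega> (\<lambda>s. c r (\<omega> s)) x y" for x y
      by (simp add: \<Psi> Q r)
    from wave_sum_cancel[OF S this] show "\<forall>s\<in>S. a r s 0 = c r (\<omega> s)"
      by blast
  next
    assume "\<forall>s\<in>S. a r s 0 = c r (\<omega> s)"
    then show "\<forall>x y. \<Psi> 0 r x y = Q r x y"
      by (simp add: \<Psi> Q r wave_sum_def)
  qed
  moreover have "diffusion_solution N \<beta> \<Psi> \<longleftrightarrow> (\<forall>s\<in>S. ode_solution N \<beta> (\<omega> s) (\<lambda>t r. a r s t))"
    by (rule diffusion_solution_wave_sum_iff[OF N S diff \<Psi>])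
  ultimately show ?thesis
    by blast
qed

theorem theorem1:
  fixes N :: nat and \<beta> :: real
  assumes "N \<ge> 1" and "\<beta> > 0"
  shows
    "(\<forall>(k :: nat) (\<omega> :: nat \<Rightarrow> real \<times> real) (K :: (real \<times> real) set)
        (c :: nat \<Rightarrow> real \<times> real \<Rightarrow> complex) (Q :: nat \<Rightarrow> real \<Rightarrow> real \<Rightarrow> complex)
        (a :: nat \<Rightarrow> nat \<Rightarrow> real \<Rightarrow> complex) (\<Psi> :: real \<Rightarrow> nat \<Rightarrow> real \<Rightarrow> real \<Rightarrow> complex).
        inj_on \<omega> {0..k} \<longrightarrow> K = \<omega> ` {0..k} \<longrightarrow>
        Q \<in> SE2_trig N K \<longrightarrow>
        (\<forall>r<N. \<forall>x y. Q r x y = (\<Sum>s=0..k. c r (\<omega> s) * plane_wave (\<omega> s) x y)) \<longrightarrow>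
        (\<forall>r<N. \<forall>s\<le>k. a r s differentiable_on {0..}) \<longrightarrow>
        (\<forall>t\<ge>0. \<forall>r<N. \<forall>x y. \<Psi> t r x y = (\<Sum>s=0..k. a r s t * plane_wave (\<omega> s) x y)) \<longrightarrow>
        (\<forall>t\<ge>0. \<Psi> t \<in> SE2_trig N K) \<and>
        ((diffusion_solution N \<beta> \<Psi> \<and> (\<forall>r<N. \<forall>x y. \<Psi> 0 r x y = Q r x y)) \<longleftrightarrow>
         (\<forall>s\<le>k. ode_solution N \<beta> (\<omega> s) (\<lambda>t r. a r s t) \<and> (\<forall>r<N. a r s 0 = c r (\<omega> s)))))
     \<and>
     (\<forall>(C :: (real \<times> real \<times> nat) set) (f :: real \<times> real \<times> nat \<Rightarrow> complex) (\<epsilon> :: real).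
        C \<subseteq> SE2 N \<longrightarrow> compact C \<longrightarrow> continuous_on C f \<longrightarrow> \<epsilon> > 0 \<longrightarrow>
        (\<exists>K Q. finite K \<and> Q \<in> SE2_trig N K \<and>
           (\<forall>(x, y, r)\<in>C. cmod (f (x, y, r) - Q r x y) < \<epsilon>)))"
proof (rule conjI, goal_cases)
  case 1
  show ?case
  proof (intro allI impI, goal_cases)
    case (1 k \<omega> K c Q a \<Psi>)
    have S: "finite {0..k}" "inj_on \<omega> {0..k}"
      using 1(1) by simp_all
    have Q: "Q r x y = wave_sum {0..k} \<omega> (\<lambda>s. c r (\<omega> s)) x y" if "r < N" for r x y
      using 1(4) that by (simp add: wave_sum_def)
    have \<Psi>: "\<Psi> t r x y = wave_sum {0..k} \<omega> (\<lambda>s. a r s t) x y" if "t \<ge> 0" "r < N" for t r x y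
      using 1(6) that by (simp add: wave_sum_def)
    have diff: "a r s differentiable_on {0..}" if "r < N" "s \<in> {0..k}" for r s
      using 1(5) that by simp
    have "\<Psi> t \<in> SE2_trig N K" if "t \<ge> 0" for t
      unfolding 1(2) by (rule wave_sums_in_SE2_trig[OF S \<Psi>[OF that]])
    moreover have "(diffusion_solution N \<beta> \<Psi> \<and> (\<forall>r<N. \<forall>x y. \<Psi> 0 r x y = Q r x y)) \<longleftrightarrow>
        (\<forall>s\<in>{0..k}. ode_solution N \<beta> (\<omega> s) (\<lambda>t r. a r s t) \<and> (\<forall>r<N. a r s 0 = c r (\<omega> s)))"
      by (rule diffusion_reduces_to_odes[OF assms(1) S Q diff \<Psi>])
    ultimately show ?case
      by (simp add: Ball_def)
  qed
next
  case 2
  show ?case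
    by (intro allI impI SE2_trig_dense)
qed

end
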